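(* Let $T$ be a finite tree of order $n(T)\ge 3$ that is $q$-critical, where $q\ge 1$ is an integer. Then $q=n(T)-1$ if and only if $T$ is isomorphic to $K_{1,r}\odot K_1$ for some integer $r\ge 1$.
   Context: All graphs are finite and simple; $n(G)$ is the number of vertices of $G$. A set $D\subseteq V(G)$ is dominating if every vertex of $V(G)\setminus D$ has a neighbour in $D$; $\gamma(G)$ is the minimum cardinality of a dominating set of $G$. For $F\subseteq E(G)$, $G_F$ denotes the graph obtained from $G$ by subdividing each edge of $F$ exactly once (each edge $uv\in F$ is replaced by a path $u,w,v$ with a new vertex $w$). For an integer $q\ge 1$, a connected graph $G$ of order at least $3$ is called $q$-critical ($\gamma$-$q$-critical) if $\gamma(G_F)>\gamma(G)$ for every $F\subseteq E(G)$ with $|F|=q$, and there is a set $F'\subseteq E(G)$ with $|F'|=q-1$ such that $\gamma(G_{F'})=\gamma(G)$. The corona $G\odot K_1$ is the graph obtained from $G$ by attaching to each vertex $v$ of $G$ exactly one new vertex of degree one adjacent to $v$. $K_{1,r}$ is the star with $r$ leaves. (The graphs $K_{1,r}\odot K_1$ are the slightly wounded spiders, i.e. the graphs obtained from a star $K_{1,t}$, $t=r+1\ge 2$, by subdividing exactly $t-1$ of its edges.) *)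

theory Defs
  imports Main
begin

text \<open>
  Finite simple undirected graphs, with edges as two-element sets of vertices. The notion
  \<open>tree\<close> of the AFP entry Graph-Theory is not suitable here: it forbids directed cycles, and every
  undirected edge, seen as a pair of opposite arcs, is a directed cycle of length two.
\<close>

record 'a graph =
  verts :: "'a set"
  edges :: "'a set set"

definition simple_graph :: "'a graph \<Rightarrow> bool" where
  "simple_graph G \<longleftrightarrow> finite (verts G) \<and> (\<forall>e \<in> edges G. e \<subseteq> verts G \<and> card e = 2)"

definition connected_graph :: "'a graph \<Rightarrow> bool" where
  "connected_graph G \<longleftrightarrow> verts G \<noteq> {} \<and>
     (\<forall>u \<in> verts G. \<forall>v \<in> verts G. (u, v) \<in> {(x, y). {x, y} \<in> edges G}\<^sup>*)"

text \<open>A cycle is the list of its distinct vertices; the last one is adjacent to the first.\<close>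

definition is_cycle :: "'a graph \<Rightarrow> 'a list \<Rightarrow> bool" where
  "is_cycle G c \<longleftrightarrow> 3 \<le> length c \<and> distinct c \<and>
     (\<forall>i < length c. {c ! i, c ! (Suc i mod length c)} \<in> edges G)"

definition is_tree :: "'a graph \<Rightarrow> bool" where
  "is_tree G \<longleftrightarrow> simple_graph G \<and> connected_graph G \<and> (\<nexists>c. is_cycle G c)"

definition graph_iso :: "'a graph \<Rightarrow> 'b graph \<Rightarrow> bool" where
  "graph_iso G H \<longleftrightarrow> (\<exists>f. bij_betw f (verts G) (verts H) \<and>
     (\<forall>u \<in> verts G. \<forall>v \<in> verts G. {u, v} \<in> edges G \<longleftrightarrow> {f u, f v} \<in> edges H))"

definition dominating :: "'a graph \<Rightarrow> 'a set \<Rightarrow> bool" where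
  "dominating G D \<longleftrightarrow> D \<subseteq> verts G \<and> (\<forall>v \<in> verts G - D. \<exists>u \<in> D. {v, u} \<in> edges G)"

definition domination_number :: "'a graph \<Rightarrow> nat" where
  "domination_number G = Min {card D | D. dominating G D}"

text \<open>
  The graph \<open>G\<^sub>F\<close>, for \<open>F \<subseteq> edges G\<close>: an old vertex \<open>v\<close> becomes \<open>Inl v\<close>, and the vertex
  subdividing the edge \<open>e \<in> F\<close> is \<open>Inr e\<close>.
\<close>

definition subdivide :: "'a graph \<Rightarrow> 'a set set \<Rightarrow> ('a + 'a set) graph" where
  "subdivide G F =
     \<lparr> verts = Inl ` verts G \<union> Inr ` F,
       edges = {Inl ` e | e. e \<in> edges G - F} \<union> {{Inl u, Inr e} | u e. e \<in> F \<and> u \<in> e} \<rparr>"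

definition q_critical :: "nat \<Rightarrow> 'a graph \<Rightarrow> bool" where
  "q_critical q G \<longleftrightarrow> 1 \<le> q \<and> simple_graph G \<and> connected_graph G \<and> 3 \<le> card (verts G) \<and>
     (\<forall>F \<subseteq> edges G. card F = q \<longrightarrow> domination_number (subdivide G F) > domination_number G) \<and>
     (\<exists>F' \<subseteq> edges G. card F' = q - 1 \<and> domination_number (subdivide G F') = domination_number G)"

text \<open>The corona \<open>G \<odot> K\<^sub>1\<close>; the new leaf attached to \<open>Inl v\<close> is \<open>Inr v\<close>.\<close>

definition corona_K1 :: "'a graph \<Rightarrow> ('a + 'a) graph" where
  "corona_K1 G =
     \<lparr> verts = Inl ` verts G \<union> Inr ` verts G,
       edges = {Inl ` e | e. e \<in> edges G} \<union> {{Inl v, Inr v} | v. v \<in> verts G} \<rparr>"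

definition star :: "nat \<Rightarrow> nat graph" where
  "star r = \<lparr> verts = {0..r}, edges = {{0, i} | i. i \<in> {1..r}} \<rparr>"

lemma simple_graph_subdivide:
  assumes "simple_graph G" "F \<subseteq> edges G"
  shows "simple_graph (subdivide G F)"
proof -
  have "finite (edges G)"
    using assms(1) by (auto simp: simple_graph_def intro!: finite_subset[of "edges G" "Pow (verts G)"])
  then have "finite F" using assms(2) finite_subset by blast
  then show ?thesis
    using assms by (fastforce simp: simple_graph_def subdivide_def card_image)
qed

lemma simple_graph_corona_K1: "simple_graph G \<Longrightarrow> simple_graph (corona_K1 G)"
  by (fastforce simp: simple_graph_def corona_K1_def card_image)

lemma simple_graph_star: "simple_graph (star r)"
  by (auto simp: simple_graph_def star_def)

end

theory Submission
  imports Defs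
begin

text \<open>
  A graph without isolated vertices has \<open>2 \<gamma> \<le> n\<close>. Let \<open>F'\<close> be all edges but one edge \<open>e\<close> of \<open>T\<close>, and
  let a minimum dominating set of \<open>T\<^sub>F\<^sub>'\<close> consist of a set \<open>A\<close> of old vertices and a set \<open>B\<close> of
  subdivided edges. Outside \<open>A\<close>, a vertex lies on an edge of \<open>B\<close>, with at most one exception,
  which is then joined to \<open>A\<close> by \<open>e\<close>. So \<open>n \<le> |A| + 2 |B| + 1\<close>, whereas \<open>2 |A| + 2 |B| \<le> n\<close> if
  \<open>\<gamma>(T\<^sub>F\<^sub>') = \<gamma>(T)\<close>. Hence \<open>|A| \<le> 1\<close>, the set \<open>B\<close> is a matching, and all edges outside \<open>B\<close>
  meet \<open>A\<close>; connectedness and the absence of triangles leave only \<open>K\<^bsub>1,r\<^esub> \<odot> K\<^sub>1\<close>.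

  Conversely, in \<open>K\<^bsub>1,r\<^esub> \<odot> K\<^sub>1\<close> every \<open>F\<close> avoiding the pendant edge at the centre satisfies
  \<open>\<gamma>(T\<^sub>F) = r + 1\<close>, but subdividing all edges forces a further vertex, since no vertex that
  dominates a leaf dominates the subdivision vertex of an edge of the star \<open>K\<^bsub>1,r\<^esub>\<close>.
\<close>

section \<open>Forests\<close>

lemma simple_graph_edgeE:
  assumes "simple_graph G" "e \<in> edges G"
  obtains x y where "e = {x, y}" "x \<noteq> y" "x \<in> verts G" "y \<in> verts G"
proof -
  have "card e = 2" "e \<subseteq> verts G" using assms by (auto simp: simple_graph_def)
  then show ?thesis using that by (auto simp: card_2_iff)
qed

lemma finite_edges: "simple_graph G \<Longrightarrow> finite (edges G)"
  by (auto simp: simple_graph_def intro!: finite_subset[of "edges G" "Pow (verts G)"])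

text \<open>A longest path starts at such a vertex \<open>v\<close>: by maximality all neighbours of
  \<open>v\<close> lie on the path, and one at position 2 or later would close a cycle with the
  initial segment. So the second vertex of the path is the only possible neighbour.\<close>

lemma acyclic_degree_le_1:
  assumes G: "simple_graph G" and ac: "\<nexists>c. is_cycle G c" and ne: "verts G \<noteq> {}"
  obtains v where "v \<in> verts G" "card {e \<in> edges G. v \<in> e} \<le> 1"
proof -
  define P where "P p \<longleftrightarrow> distinct p \<and> p \<noteq> [] \<and> set p \<subseteq> verts G \<and>
      (\<forall>i. Suc i < length p \<longrightarrow> {p ! i, p ! Suc i} \<in> edges G)" for p
  have fin: "finite (verts G)" using G by (simp add: simple_graph_def)
  obtain w where "w \<in> verts G" using ne by blast
  then have "P [w]" by (simp add: P_def)
  moreover have "length p < Suc (card (verts G))" if "P p" for p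
    using that card_mono[OF fin, of "set p"] by (auto simp: P_def distinct_card)
  ultimately obtain p where p: "P p" and max: "\<And>p'. P p' \<Longrightarrow> length p' \<le> length p"
    using ex_has_greatest_nat[of P "[w]" length "Suc (card (verts G))"] by metis
  define v where "v = p ! 0"
  have lp: "0 < length p" using p by (simp add: P_def)
  then have v: "v \<in> verts G" using p by (auto simp: P_def v_def)
  have nb: "u \<noteq> v \<and> u = p ! 1 \<and> e = {v, p ! 1}" if e: "e \<in> edges G" "e = {v, u}" for e u
  proof -
    have uv: "u \<noteq> v" "u \<in> verts G" using G e by (auto simp: simple_graph_def)
    have "u \<in> set p"
    proof (rule ccontr)
      assume "u \<notin> set p"
      \<comment> \<open>A neighbour off the path could be put in front of it, giving a longer
        path.\<close>
      have "P (u # p)"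
        unfolding P_def
      proof (intro conjI allI impI)
        fix i assume "Suc i < length (u # p)"
        then show "{(u # p) ! i, (u # p) ! Suc i} \<in> edges G"
          using p e by (cases i) (auto simp: P_def v_def insert_commute)
      qed (use p uv \<open>u \<notin> set p\<close> in \<open>auto simp: P_def\<close>)
      then show False using max by fastforce
    qed
    then obtain k where k: "k < length p" "p ! k = u" by (auto simp: in_set_conv_nth)
    have "k \<noteq> 0" using k uv(1) v_def by metis
    moreover have "\<not> 2 \<le> k"
    proof
      assume k2: "2 \<le> k"
      have "is_cycle G (take (Suc k) p)"
        unfolding is_cycle_def
      proof (intro conjI allI impI)
        show "3 \<le> length (take (Suc k) p)" using k2 k by simp
        show "distinct (take (Suc k) p)" using p by (simp add: P_def)
        fix i assume "i < length (take (Suc k) p)"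
        then have "i \<le> k" by simp
        then show "{take (Suc k) p ! i, take (Suc k) p ! (Suc i mod length (take (Suc k) p))} \<in> edges G"
          using k e p by (cases "i = k") (auto simp: P_def v_def insert_commute)
      qed
      then show False using ac by blast
    qed
    ultimately have "k = 1" by simp
    then show ?thesis using k e uv by simp
  qed
  have "e = {v, p ! 1}" if e: "e \<in> edges G" "v \<in> e" for e
  proof -
    obtain x y where "e = {x, y}" using simple_graph_edgeE[OF G e(1)] .
    then obtain u where "e = {v, u}" using e(2) by (auto simp: insert_commute)
    then show ?thesis using nb e(1) by blast
  qed
  \<comment> \<open>If \<open>p\<close> has length 1, then \<open>p ! 1\<close> is unspecified; but
    then \<open>v\<close> has no neighbour at all, so the inclusion still holds.\<close>
  then have "{e \<in> edges G. v \<in> e} \<subseteq> {{v, p ! 1}}" by blast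
  then have "card {e \<in> edges G. v \<in> e} \<le> 1" using card_mono[of "{{v, p ! 1}}"] by simp
  then show ?thesis using v that by blast
qed

text \<open>Induction on the order: deleting a vertex of degree at most 1 leaves a forest and
  destroys at most one edge.\<close>

lemma acyclic_card_edges:
  assumes "simple_graph G" "\<nexists>c. is_cycle G c"
  shows "card (edges G) \<le> card (verts G) - 1"
  using assms
proof (induction "card (verts G)" arbitrary: G rule: less_induct)
  case (less G)
  have fin: "finite (verts G)" using less.prems by (simp add: simple_graph_def)
  show ?case
  proof (cases "card (verts G) \<le> 1")
    case True
    \<comment> \<open>Orders 0 and 1 are the base case; subtraction is truncated, so the bound is 0
      for both.\<close>
    have "edges G = {}"
    proof (rule equals0I)
      fix e assume "e \<in> edges G"
      then show False
        using less.prems(1) True fin card_mono[of "verts G" e] by (auto simp: simple_graph_def)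
    qed
    then show ?thesis by simp
  next
    case False
    then have "verts G \<noteq> {}" by auto
    then obtain v where v: "v \<in> verts G" "card {e \<in> edges G. v \<in> e} \<le> 1"
      using acyclic_degree_le_1 less.prems by blast
    define H where "H = \<lparr> verts = verts G - {v}, edges = {e \<in> edges G. v \<notin> e} \<rparr>"
    have "simple_graph H" using less.prems(1) by (auto simp: simple_graph_def H_def)
    moreover have "\<nexists>c. is_cycle H c" using less.prems(2) by (auto simp: is_cycle_def H_def)
    moreover have cv: "card (verts H) = card (verts G) - 1" using v fin by (simp add: H_def)
    ultimately have "card (edges H) \<le> card (verts H) - 1" using less.hyps[of H] False by simp
    moreover have "edges G = edges H \<union> {e \<in> edges G. v \<in> e}" by (auto simp: H_def)
    then have "card (edges G) \<le> card (edges H) + card {e \<in> edges G. v \<in> e}"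
      by (metis card_Un_le)
    ultimately show ?thesis using v(2) cv False by linarith
  qed
qed

text \<open>The form in which connectedness is applied below: a set that no edge leaves is followed
  along a walk from \<open>x\<close> to \<open>y\<close>.\<close>

lemma connected_graph_closed:
  assumes con: "connected_graph G" and x: "x \<in> S" "x \<in> verts G" and y: "y \<in> verts G"
    and cl: "\<And>u v. u \<in> S \<Longrightarrow> {u, v} \<in> edges G \<Longrightarrow> v \<in> S"
  shows "y \<in> S"
proof -
  have "(x, y) \<in> {(x, y). {x, y} \<in> edges G}\<^sup>*" using con x y unfolding connected_graph_def by blast
  then show ?thesis by (induction rule: rtrancl_induct) (use x cl in auto)
qed

section \<open>Domination\<close>

lemma domination_number_le:
  assumes "finite (verts G)" "dominating G D"
  shows "domination_number G \<le> card D"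
proof -
  have "{card D | D. dominating G D} \<subseteq> card ` Pow (verts G)" by (auto simp: dominating_def)
  then have "finite {card D | D. dominating G D}"
    by (rule finite_subset) (simp add: assms(1))
  then show ?thesis using assms(2) unfolding domination_number_def by (intro Min_le) auto
qed

lemma domination_number_attained:
  assumes "finite (verts G)"
  obtains D where "dominating G D" "card D = domination_number G"
proof -
  have "{card D | D. dominating G D} \<subseteq> card ` Pow (verts G)" by (auto simp: dominating_def)
  then have "finite {card D | D. dominating G D}"
    by (rule finite_subset) (simp add: assms(1))
  moreover have "dominating G (verts G)" by (simp add: dominating_def)
  then have "{card D | D. dominating G D} \<noteq> {}" by blast
  ultimately have "domination_number G \<in> {card D | D. dominating G D}"
    unfolding domination_number_def by (rule Min_in)
  then show ?thesis using that by auto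
qed

text \<open>Ore's bound: the complement of a minimum dominating set \<open>D\<close> also dominates,
  so the smaller of the two has at most half of the vertices. A vertex of \<open>D\<close> without
  neighbours outside \<open>D\<close> could be dropped from \<open>D\<close>: it has a neighbour in
  \<open>D\<close> and is needed by no vertex outside.\<close>

lemma domination_number_le_half:
  assumes fin: "finite (verts G)"
    and noniso: "\<And>v. v \<in> verts G \<Longrightarrow> \<exists>u \<in> verts G. u \<noteq> v \<and> {v, u} \<in> edges G"
  shows "2 * domination_number G \<le> card (verts G)"
proof -
  obtain D where D: "dominating G D" "card D = domination_number G"
    using domination_number_attained[OF fin] .
  have DV: "D \<subseteq> verts G" using D by (simp add: dominating_def)
  then have finD: "finite D" using fin finite_subset by blast
  have "dominating G (verts G - D)"
    unfolding dominating_def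
  proof (intro conjI ballI)
    fix v assume "v \<in> verts G - (verts G - D)"
    then have v: "v \<in> D" "v \<in> verts G" by auto
    show "\<exists>u \<in> verts G - D. {v, u} \<in> edges G"
    proof (rule ccontr)
      assume no: "\<not> ?thesis"
      have "dominating G (D - {v})"
        unfolding dominating_def
      proof (intro conjI ballI)
        fix w assume w: "w \<in> verts G - (D - {v})"
        show "\<exists>u \<in> D - {v}. {w, u} \<in> edges G"
        proof (cases "w = v")
          case True
          then show ?thesis using noniso[OF v(2)] no by blast
        next
          case False
          then have "w \<in> verts G - D" using w by blast
          moreover then obtain u where "u \<in> D" "{w, u} \<in> edges G"
            using D by (auto simp: dominating_def)
          ultimately show ?thesis using no by (metis DiffI insert_commute singletonD)
        qed
      qed (use DV in auto)
      then have "card D \<le> card (D - {v})" using domination_number_le[OF fin] D(2) by metis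
      then show False using card_Diff1_less[OF finD v(1)] by simp
    qed
  qed simp
  then have "domination_number G \<le> card (verts G - D)" using domination_number_le fin by blast
  then show ?thesis using D(2) card_Diff_subset[OF finD DV] card_mono[OF fin DV] by simp
qed

text \<open>Moves domination in the subdivided graph back to \<open>G\<close>. Old vertices stay
  adjacent exactly along unsubdivided edges, a subdivision vertex is adjacent to the two ends of its
  edge, and no two subdivision vertices are adjacent.\<close>

lemma dominating_subdivide:
  "dominating (subdivide G F) (A <+> B) \<longleftrightarrow> A \<subseteq> verts G \<and> B \<subseteq> F \<and>
     (\<forall>v \<in> verts G - A. (\<exists>e \<in> B. v \<in> e) \<or> (\<exists>u \<in> A. {v, u} \<in> edges G - F)) \<and>
     (\<forall>e \<in> F - B. \<exists>u \<in> A. u \<in> e)"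
proof (cases "A \<subseteq> verts G \<and> B \<subseteq> F")
  case True
  let ?E = "edges (subdivide G F)"
  have 1: "{Inl v, Inl u} \<in> ?E \<longleftrightarrow> {v, u} \<in> edges G - F" for v u
  proof -
    have "({Inl v, Inl u} :: ('a + 'a set) set) = Inl ` e \<longleftrightarrow> e = {v, u}" for e
      using inj_image_eq_iff[OF inj_Inl, of "{v, u}" e] by auto
    then show ?thesis by (auto simp: subdivide_def doubleton_eq_iff)
  qed
  have 2: "{Inl v, Inr e} \<in> ?E \<longleftrightarrow> e \<in> F \<and> v \<in> e" for v e
    by (auto simp: subdivide_def doubleton_eq_iff)
  have 3: "{Inr e, Inr f} \<notin> ?E" for e f
    by (auto simp: subdivide_def doubleton_eq_iff)
  have V: "verts (subdivide G F) = verts G <+> F" by (auto simp: subdivide_def)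
  have 4: "{Inr e, Inl v} \<in> ?E \<longleftrightarrow> e \<in> F \<and> v \<in> e" for v e
    using 2[of v e] by (simp add: insert_commute)
  have "dominating (subdivide G F) (A <+> B) \<longleftrightarrow>
      (\<forall>v \<in> verts G - A. \<exists>u \<in> A <+> B. {Inl v, u} \<in> ?E) \<and>
      (\<forall>e \<in> F - B. \<exists>u \<in> A <+> B. {Inr e, u} \<in> ?E)"
    unfolding dominating_def V using True by blast
  also have "\<dots> \<longleftrightarrow> (\<forall>v \<in> verts G - A. (\<exists>u \<in> A. {Inl v, Inl u} \<in> ?E) \<or> (\<exists>e \<in> B. {Inl v, Inr e} \<in> ?E)) \<and>
      (\<forall>e \<in> F - B. (\<exists>u \<in> A. {Inr e, Inl u} \<in> ?E) \<or> (\<exists>f \<in> B. {Inr e, Inr f} \<in> ?E))"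
    by (simp add: Plus_def bex_Un)
  also have "\<dots> \<longleftrightarrow> (\<forall>v \<in> verts G - A. (\<exists>e \<in> B. v \<in> e) \<or> (\<exists>u \<in> A. {v, u} \<in> edges G - F)) \<and>
      (\<forall>e \<in> F - B. \<exists>u \<in> A. u \<in> e)"
  proof -
    have "(\<exists>e \<in> B. {Inl v, Inr e} \<in> ?E) \<longleftrightarrow> (\<exists>e \<in> B. v \<in> e)" for v
      using 2 True by blast
    moreover have "(\<exists>u \<in> A. {Inr e, Inl u} \<in> ?E) \<longleftrightarrow> (\<exists>u \<in> A. u \<in> e)" if "e \<in> F - B" for e
      using 4 that by blast
    ultimately show ?thesis by (simp add: 1 3 disj_commute)
  qed
  finally show ?thesis using True by simp
next
  case False
  then show ?thesis by (auto simp: dominating_def subdivide_def)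
qed

lemma set_eq_Plus: "D = {v. Inl v \<in> D} <+> {e. Inr e \<in> D}"
  by (auto simp: Plus_def image_iff split: sum.splits) (metis sum.exhaust)

lemma domination_number_subdivide_attained:
  assumes "simple_graph G" "F \<subseteq> edges G"
  obtains A B where "dominating (subdivide G F) (A <+> B)" "finite A" "finite B"
    "card A + card B = domination_number (subdivide G F)"
proof -
  have fin: "finite (verts (subdivide G F))"
    using simple_graph_subdivide[OF assms] by (simp add: simple_graph_def)
  then obtain D where D: "dominating (subdivide G F) D" "card D = domination_number (subdivide G F)"
    using domination_number_attained by blast
  define A B where "A = {v. Inl v \<in> D}" and "B = {e. Inr e \<in> D}"
  have DAB: "D = A <+> B" unfolding A_def B_def by (rule set_eq_Plus)
  have "finite D" using D(1) fin finite_subset by (auto simp: dominating_def)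
  then have "finite A" "finite B" by (auto simp: DAB finite_Plus_iff)
  then show ?thesis using that[of A B] D by (simp add: DAB card_Plus)
qed

text \<open>The equality case of the union bound: a shared point \<open>x\<close> would make
  \<open>e\<close> contribute at most one new point, so the union would have at most
  \<open>2 * (card B - 1) + 1\<close> points.\<close>

lemma disjoint_if_card_Union:
  assumes fin: "finite B" and two: "\<And>e. e \<in> B \<Longrightarrow> card e = 2"
    and c: "2 * card B \<le> card (\<Union>B)" and ef: "e \<in> B" "f \<in> B" "e \<noteq> f"
  shows "e \<inter> f = {}"
proof (rule ccontr)
  assume "e \<inter> f \<noteq> {}"
  then obtain x where x: "x \<in> e" "x \<in> f" by blast
  have "finite e" "card (e - {x}) = 1"
    using two[OF ef(1)] x(1) by (auto intro: card_ge_0_finite)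
  moreover have "\<Union>B = \<Union>(B - {e}) \<union> (e - {x})" using x ef by auto
  ultimately have "card (\<Union>B) \<le> card (\<Union>(B - {e})) + 1" by (metis card_Un_le)
  moreover have "card (\<Union>(B - {e})) \<le> (\<Sum>g \<in> B - {e}. card g)"
    by (rule card_Union_le_sum_card)
  moreover have "\<dots> = 2 * (card B - 1)" using two ef(1) fin by simp
  moreover have "0 < card B" using ef(1) fin card_gt_0_iff by blast
  ultimately show False using c by linarith
qed

section \<open>Coronas of stars\<close>

text \<open>Coordinates on \<open>T\<close> that replace an isomorphism with the corona and its sum
  type: \<open>s 0\<close> is the centre of the star, the other \<open>s i\<close> are its leaves,
  and \<open>l i\<close> is the pendant vertex at \<open>s i\<close>.\<close>

definition star_corona_labelling :: "'a graph \<Rightarrow> nat \<Rightarrow> (nat \<Rightarrow> 'a) \<Rightarrow> (nat \<Rightarrow> 'a) \<Rightarrow> bool" where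
  "star_corona_labelling T r s l \<longleftrightarrow> inj_on s {0..r} \<and> inj_on l {0..r} \<and> s ` {0..r} \<inter> l ` {0..r} = {} \<and>
     verts T = s ` {0..r} \<union> l ` {0..r} \<and>
     edges T = (\<lambda>i. {s 0, s i}) ` {1..r} \<union> (\<lambda>i. {s i, l i}) ` {0..r}"

lemma verts_star_corona: "verts (corona_K1 (star r)) = {0..r} <+> {0..r}"
  by (auto simp: corona_K1_def star_def)

lemma edges_star_corona:
  "edges (corona_K1 (star r)) = (\<lambda>i. {Inl 0, Inl i}) ` {1..r} \<union> (\<lambda>i. {Inl i, Inr i}) ` {0..r}"
proof -
  have "edges (corona_K1 G) = (`) Inl ` edges G \<union> (\<lambda>i. {Inl i, Inr i}) ` verts G" for G :: "nat graph"
    by (auto simp: corona_K1_def)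
  moreover have "edges (star r) = (\<lambda>i. {0, i}) ` {1..r}" by (auto simp: star_def)
  moreover have "verts (star r) = {0..r}" by (simp add: star_def)
  ultimately have "edges (corona_K1 (star r)) = (`) Inl ` ((\<lambda>i. {0, i}) ` {1..r}) \<union> (\<lambda>i. {Inl i, Inr i}) ` {0..r}"
    by metis
  then show ?thesis by (simp add: image_image)
qed

text \<open>Isomorphism is defined by comparing pairs of vertices; this turns it into an equation
  between edge sets, from which the edges of a labelled tree can be read off.\<close>

lemma graph_iso_edges:
  assumes "simple_graph G" "simple_graph H" and f: "bij_betw f (verts H) (verts G)"
    and fe: "\<And>u v. u \<in> verts H \<Longrightarrow> v \<in> verts H \<Longrightarrow> {u, v} \<in> edges H \<longleftrightarrow> {f u, f v} \<in> edges G"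
  shows "edges G = (`) f ` edges H"
proof
  show "(`) f ` edges H \<subseteq> edges G"
  proof
    fix e assume "e \<in> (`) f ` edges H"
    then obtain d where d: "d \<in> edges H" "e = f ` d" by blast
    obtain u v where "d = {u, v}" "u \<in> verts H" "v \<in> verts H"
      using simple_graph_edgeE[OF assms(2) d(1)] by metis
    then show "e \<in> edges G" using d fe by simp
  qed
  show "edges G \<subseteq> (`) f ` edges H"
  proof
    fix e assume e: "e \<in> edges G"
    then obtain x y where xy: "e = {x, y}" "x \<in> verts G" "y \<in> verts G"
      using simple_graph_edgeE[OF assms(1)] by metis
    then obtain u v where "x = f u" "y = f v" "u \<in> verts H" "v \<in> verts H"
      using f unfolding bij_betw_def by blast
    then have "e = f ` {u, v}" "{u, v} \<in> edges H" using fe e xy by auto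
    then show "e \<in> (`) f ` edges H" by blast
  qed
qed

lemma star_corona_labelling_if_iso:
  assumes T: "simple_graph T" and iso: "graph_iso T (corona_K1 (star r))"
  obtains s l where "star_corona_labelling T r s l"
proof -
  let ?H = "corona_K1 (star r)"
  obtain f where f: "bij_betw f (verts T) (verts ?H)"
    and fe: "\<And>u v. u \<in> verts T \<Longrightarrow> v \<in> verts T \<Longrightarrow> {u, v} \<in> edges T \<longleftrightarrow> {f u, f v} \<in> edges ?H"
    using iso by (auto simp: graph_iso_def)
  define g where "g = inv_into (verts T) f"
  have g: "bij_betw g (verts ?H) (verts T)" unfolding g_def by (rule bij_betw_inv_into[OF f])
  have "edges T = (`) g ` edges ?H"
  proof (rule graph_iso_edges[OF T _ g])
    fix u v assume uv: "u \<in> verts ?H" "v \<in> verts ?H"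
    then have "f (g u) = u" "f (g v) = v" "g u \<in> verts T" "g v \<in> verts T"
      using f g by (auto simp: g_def bij_betw_inv_into_right bij_betw_apply)
    then show "{u, v} \<in> edges ?H \<longleftrightarrow> {g u, g v} \<in> edges T" using fe by auto
  qed (simp add: simple_graph_corona_K1 simple_graph_star)
  then have "edges T = (\<lambda>i. {g (Inl 0), g (Inl i)}) ` {1..r} \<union> (\<lambda>i. {g (Inl i), g (Inr i)}) ` {0..r}"
    by (simp add: edges_star_corona image_Un image_image)
  moreover have gi: "inj_on g ({0..r} <+> {0..r})" and gV: "verts T = g ` ({0..r} <+> {0..r})"
    using g by (auto simp: bij_betw_def verts_star_corona)
  moreover have "inj_on (\<lambda>i. g (Inl i)) {0..r}" "inj_on (\<lambda>i. g (Inr i)) {0..r}"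
    using gi by (auto simp: inj_on_def)
  moreover have "g (Inl i) \<noteq> g (Inr j)" if "i \<le> r" "j \<le> r" for i j
    using that by (subst inj_on_eq_iff[OF gi]) auto
  then have "(\<lambda>i. g (Inl i)) ` {0..r} \<inter> (\<lambda>i. g (Inr i)) ` {0..r} = {}" by auto
  ultimately have "star_corona_labelling T r (\<lambda>i. g (Inl i)) (\<lambda>i. g (Inr i))"
    by (simp add: star_corona_labelling_def Plus_def image_Un image_image)
  then show ?thesis using that by blast
qed

lemma iso_if_star_corona_labelling:
  assumes "star_corona_labelling T r s l"
  shows "graph_iso T (corona_K1 (star r))"
proof -
  let ?H = "corona_K1 (star r)"
  define g where "g = case_sum s l"
  have lab: "inj_on s {0..r}" "inj_on l {0..r}" "s ` {0..r} \<inter> l ` {0..r} = {}"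
    "verts T = s ` {0..r} \<union> l ` {0..r}"
    "edges T = (\<lambda>i. {s 0, s i}) ` {1..r} \<union> (\<lambda>i. {s i, l i}) ` {0..r}"
    using assms by (auto simp: star_corona_labelling_def)
  have inj: "inj_on g (verts ?H)"
  proof (rule inj_onI)
    fix x y assume "x \<in> verts ?H" "y \<in> verts ?H" "g x = g y"
    then show "x = y"
      using lab(1-3) by (cases x; cases y) (auto simp: g_def verts_star_corona inj_on_eq_iff)
  qed
  have g: "bij_betw g (verts ?H) (verts T)"
    using inj by (auto simp: bij_betw_def lab(4) verts_star_corona g_def image_Un Plus_def image_image)
  have gE: "edges T = (`) g ` edges ?H"
    by (simp add: lab(5) edges_star_corona image_Un image_image g_def)
  have sub: "e \<subseteq> verts ?H" if "e \<in> edges ?H" for e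
    using that simple_graph_corona_K1[OF simple_graph_star] by (auto simp: simple_graph_def)
  define f where "f = inv_into (verts ?H) g"
  have f: "bij_betw f (verts T) (verts ?H)" unfolding f_def by (rule bij_betw_inv_into[OF g])
  have "{u, v} \<in> edges T \<longleftrightarrow> {f u, f v} \<in> edges ?H" if "u \<in> verts T" "v \<in> verts T" for u v
  proof -
    have fuv: "g (f u) = u" "g (f v) = v" "f u \<in> verts ?H" "f v \<in> verts ?H"
      using that f g by (auto simp: f_def bij_betw_inv_into_right bij_betw_apply)
    then have uv: "{u, v} = g ` {f u, f v}" and "{f u, f v} \<subseteq> verts ?H" by simp_all
    \<comment> \<open>Edges lie inside the vertex set, where \<open>g\<close> is injective, so equal
      images come from equal edges.\<close>
    then have "g ` {f u, f v} = g ` e \<longleftrightarrow> {f u, f v} = e" if "e \<in> edges ?H" for e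
      using inj_on_image_eq_iff[OF inj] sub that by blast
    then show ?thesis unfolding gE uv image_iff by blast
  qed
  then show ?thesis using f unfolding graph_iso_def by blast
qed

text \<open>Every edge of the matching \<open>M\<close> has exactly one end adjacent to
  \<open>a\<close>: at least one by connectedness, at most one because there is no triangle. These
  ends form a star around \<open>a\<close>; the other ends are their pendant vertices, and
  \<open>b\<close> is the pendant vertex of \<open>a\<close>.\<close>

lemma tree_matching_iso_star_corona:
  assumes T: "is_tree T" and ab: "a \<noteq> b" "{a, b} \<in> edges T" and M: "M \<subseteq> edges T" "M \<noteq> {}"
    and V: "verts T = {a, b} \<union> \<Union>M" and abM: "a \<notin> \<Union>M" "b \<notin> \<Union>M"
    and dj: "\<And>e f. e \<in> M \<Longrightarrow> f \<in> M \<Longrightarrow> e \<noteq> f \<Longrightarrow> e \<inter> f = {}"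
    and E: "\<And>e. e \<in> edges T \<Longrightarrow> e \<noteq> {a, b} \<Longrightarrow> e \<notin> M \<Longrightarrow> a \<in> e"
  shows "\<exists>r \<ge> 1. graph_iso T (corona_K1 (star r))"
proof -
  have sg: "simple_graph T" and con: "connected_graph T" and ac: "\<nexists>c. is_cycle T c"
    using T by (auto simp: is_tree_def)
  have ex: "\<exists>x y. e = {x, y} \<and> x \<noteq> y \<and> {a, x} \<in> edges T \<and> {a, y} \<notin> edges T" if e: "e \<in> M" for e
  proof -
    have "e \<in> edges T" using M e by blast
    then obtain x y where xy: "e = {x, y}" "x \<noteq> y" using simple_graph_edgeE[OF sg] by metis
    have "\<exists>x \<in> e. {a, x} \<in> edges T"
    proof (rule ccontr)
      assume no: "\<not> ?thesis"
      \<comment> \<open>If no end of \<open>e\<close> is adjacent to \<open>a\<close>, then no edge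
        leaves \<open>e\<close>: an edge at an end of \<open>e\<close> does not meet
        \<open>a\<close>, so it belongs to \<open>M\<close> and equals \<open>e\<close> by
        disjointness. Connectedness would then put \<open>a\<close> itself into
        \<open>e\<close>.\<close>
      have "a \<in> e"
      proof (rule connected_graph_closed[OF con, of x])
        fix u v assume uv: "u \<in> e" "{u, v} \<in> edges T"
        then have "u \<noteq> a" "u \<noteq> b" using abM e by auto
        then have "{u, v} \<in> M" using E[OF uv(2)] no uv by (auto simp: doubleton_eq_iff insert_commute)
        then have "{u, v} = e" using dj[OF _ e] uv(1) by blast
        then show "v \<in> e" by blast
      qed (use xy V e in auto)
      then show False using abM e by blast
    qed
    \<comment> \<open>Otherwise \<open>a\<close>, \<open>x\<close>, \<open>y\<close> form a
      triangle.\<close>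
    moreover have "\<not> ({a, x} \<in> edges T \<and> {a, y} \<in> edges T)"
    proof
      assume *: "{a, x} \<in> edges T \<and> {a, y} \<in> edges T"
      have "{x, y} \<in> edges T" "a \<noteq> x" "a \<noteq> y" using xy M e abM by auto
      then have "is_cycle T [a, x, y]"
        using * xy(2) by (auto simp: is_cycle_def less_Suc_eq insert_commute)
      then show False using ac by blast
    qed
    ultimately show ?thesis using xy by (metis empty_iff insertE insert_commute)
  qed
  then obtain S L where SL: "\<And>e. e \<in> M \<Longrightarrow> e = {S e, L e} \<and> S e \<noteq> L e \<and>
      {a, S e} \<in> edges T \<and> {a, L e} \<notin> edges T"
    by metis
  have finM: "finite M" using finite_subset[OF M(1) finite_edges[OF sg]] .
  define r where "r = card M"
  obtain h where h: "bij_betw h {1..r} M" using ex_bij_betw_nat_finite_1[OF finM] r_def by blast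
  have r1: "1 \<le> r" using M(2) finM card_gt_0_iff r_def by (metis One_nat_def Suc_leI)
  have hM: "h i \<in> M" if "i \<in> {1..r}" for i using bij_betw_apply[OF h that] .
  have Mh: "\<exists>i \<in> {1..r}. e = h i" if "e \<in> M" for e using h that by (auto simp: bij_betw_def)
  \<comment> \<open>Index 0 is kept for the edge \<open>{a, b}\<close>, which is why
    \<open>h\<close> enumerates \<open>M\<close> from 1.\<close>
  define s l where "s i = (if i = 0 then a else S (h i))" and "l i = (if i = 0 then b else L (h i))" for i :: nat
  have s0: "s 0 = a" and l0: "l 0 = b" by (simp_all add: s_def l_def)
  have hsl: "h i = {s i, l i}" "s i \<noteq> l i" "{a, s i} \<in> edges T" "{a, l i} \<notin> edges T"
    if "i \<in> {1..r}" for i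
    using SL[OF hM[OF that]] that by (auto simp: s_def l_def)
  have in_h: "i = j" if "x \<in> h i" "x \<in> h j" "i \<in> {1..r}" "j \<in> {1..r}" for x i j
  proof -
    have "h i = h j" using dj[OF hM hM] that by blast
    then show ?thesis using inj_onD[OF bij_betw_imp_inj_on[OF h]] that(3,4) by blast
  qed
  have split0: "{0..r} = insert 0 {1..r}" by auto
  have sab: "s i \<noteq> a" "s i \<noteq> b" "l i \<noteq> a" "l i \<noteq> b" if "i \<in> {1..r}" for i
    using abM hM[OF that] hsl(1)[OF that] by auto
  have slh: "s i \<in> h i" "l i \<in> h i" if "i \<in> {1..r}" for i
    using hsl(1)[OF that] by auto
  have "inj_on s {0..r}"
  proof -
    have "inj_on s {1..r}" by (rule inj_onI) (metis in_h slh(1))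
    moreover have "s 0 \<notin> s ` {1..r}" unfolding s0 using sab by blast
    ultimately show ?thesis unfolding split0 by simp
  qed
  moreover have "inj_on l {0..r}"
  proof -
    have "inj_on l {1..r}" by (rule inj_onI) (metis in_h slh(2))
    moreover have "l 0 \<notin> l ` {1..r}" unfolding l0 using sab by blast
    ultimately show ?thesis unfolding split0 by simp
  qed
  moreover have "s i \<noteq> l j" if "i \<in> {0..r}" "j \<in> {0..r}" for i j
  proof (cases "i = 0 \<or> j = 0")
    case True
    then show ?thesis using that sab[of i] sab[of j] ab(1) s0 l0
      by (cases "i = 0"; cases "j = 0") auto
  next
    case False
    then have "i \<in> {1..r}" "j \<in> {1..r}" using that by auto
    then show ?thesis using in_h[OF slh(1), of i j] slh(2)[of j] hsl(2)[of i] by metis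
  qed
  then have "s ` {0..r} \<inter> l ` {0..r} = {}" by blast
  moreover have "\<Union>M = s ` {1..r} \<union> l ` {1..r}"
  proof -
    have "M = h ` {1..r}" using h by (simp add: bij_betw_def)
    then show ?thesis using hsl(1) by auto
  qed
  then have "verts T = s ` {0..r} \<union> l ` {0..r}"
    unfolding split0 V by (auto simp: s0 l0)
  moreover have "edges T = (\<lambda>i. {s 0, s i}) ` {1..r} \<union> (\<lambda>i. {s i, l i}) ` {0..r}" (is "_ = ?R")
  proof
    show "?R \<subseteq> edges T"
      unfolding split0 using hsl(3) ab(2) hM M(1) hsl(1) by (auto simp: s0 l0)
    show "edges T \<subseteq> ?R"
    proof
      fix e assume e: "e \<in> edges T"
      consider "e = {a, b}" | "e \<in> M" | "e \<noteq> {a, b}" "e \<notin> M" by blast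
      then show "e \<in> ?R"
      proof cases
        case 1
        then show ?thesis by (auto simp: split0 s0 l0)
      next
        case 2
        then show ?thesis using Mh[OF 2] hsl(1) unfolding split0 by blast
      next
        case 3
        then have "a \<in> e" using E e by blast
        then obtain x where x: "e = {a, x}" "x \<noteq> a" "x \<in> verts T"
          using simple_graph_edgeE[OF sg e] by (metis insertE insert_commute singletonD)
        then have "x \<noteq> b" using 3 by blast
        then obtain m where m: "m \<in> M" "x \<in> m" using x V by blast
        then obtain i where i: "i \<in> {1..r}" "m = h i" using Mh by blast
        \<comment> \<open>The other end of the matching edge is ruled out, since \<open>l i\<close>
          is not adjacent to \<open>a\<close>.\<close>
        then have "x = s i" using m(2) hsl(1,4)[OF i(1)] e x(1) by auto
        then show ?thesis using i x(1) by (auto simp: s0)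
      qed
    qed
  qed
  ultimately have "star_corona_labelling T r s l" by (simp add: star_corona_labelling_def)
  then show ?thesis using iso_if_star_corona_labelling r1 by blast
qed

text \<open>The set \<open>R\<close> of old vertices covered neither by \<open>A\<close> nor by an
  edge of \<open>B\<close> has at most one element. Whether it is empty or not, the upper and lower
  bounds on the order meet, so every estimate in between is an equality.\<close>

lemma tree_iso_star_corona:
  assumes T: "is_tree T" and n: "3 \<le> card (verts T)"
    and F: "F \<subseteq> edges T" "card F = card (verts T) - 2"
    and eq: "domination_number (subdivide T F) = domination_number T"
  shows "\<exists>r \<ge> 1. graph_iso T (corona_K1 (star r))"
proof -
  have sg: "simple_graph T" and con: "connected_graph T" and ac: "\<nexists>c. is_cycle T c"
    using T by (auto simp: is_tree_def)
  have fin: "finite (verts T)" using sg by (simp add: simple_graph_def)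
  have exit: "\<exists>u \<in> S. \<exists>v \<in> verts T - S. {u, v} \<in> edges T"
    if S: "S \<subseteq> verts T" "S \<noteq> {}" "card S < card (verts T)" for S
  proof (rule ccontr)
    assume no: "\<not> ?thesis"
    obtain x where x: "x \<in> S" using S by blast
    have "verts T \<subseteq> S"
    proof
      fix y assume y: "y \<in> verts T"
      show "y \<in> S"
      proof (rule connected_graph_closed[OF con x _ y])
        fix u v assume "u \<in> S" "{u, v} \<in> edges T"
        moreover then have "v \<in> verts T" using sg by (auto simp: simple_graph_def)
        ultimately show "v \<in> S" using no by blast
      qed (use S x in auto)
    qed
    then show False using S by (metis less_irrefl subset_antisym)
  qed
  have half: "2 * domination_number T \<le> card (verts T)"
  proof (rule domination_number_le_half[OF fin])
    fix v assume "v \<in> verts T"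
    then show "\<exists>u \<in> verts T. u \<noteq> v \<and> {v, u} \<in> edges T" using exit[of "{v}"] n by auto
  qed
  obtain A B where dom: "dominating (subdivide T F) (A <+> B)" and fAB: "finite A" "finite B"
    and cAB: "card A + card B = domination_number T"
    using domination_number_subdivide_attained[OF sg F(1)] eq by metis
  have AV: "A \<subseteq> verts T" and BF: "B \<subseteq> F"
    and d1: "\<And>v. v \<in> verts T \<Longrightarrow> v \<notin> A \<Longrightarrow> v \<notin> \<Union>B \<Longrightarrow> \<exists>u \<in> A. {v, u} \<in> edges T - F"
    and d2: "\<And>e. e \<in> F \<Longrightarrow> e \<notin> B \<Longrightarrow> \<exists>u \<in> A. u \<in> e"
    using dom by (auto simp: dominating_subdivide)
  have finE: "finite (edges T)" using finite_edges[OF sg] .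
  \<comment> \<open>A forest has at most n - 1 edges and \<open>F\<close> has n - 2 of them.\<close>
  have "card (edges T - F) \<le> 1"
    using acyclic_card_edges[OF sg ac] F n finE by (simp add: card_Diff_subset finite_subset)
  then have one: "e = f" if "e \<in> edges T - F" "f \<in> edges T - F" for e f
    using that finE by (metis card_le_Suc0_iff_eq finite_Diff One_nat_def)
  have B2: "card e = 2" "e \<subseteq> verts T" if "e \<in> B" for e
    using that BF F sg by (auto simp: simple_graph_def)
  have UBV: "\<Union>B \<subseteq> verts T" using B2 by blast
  then have finUB: "finite (\<Union>B)" using fin finite_subset by blast
  have "card (\<Union>B) \<le> (\<Sum>e \<in> B. card e)" by (rule card_Union_le_sum_card)
  then have UB: "card (\<Union>B) \<le> 2 * card B" using B2 by simp
  define R where "R = verts T - A - \<Union>B"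
  have finR: "finite R" using fin by (simp add: R_def)
  have VABR: "verts T = A \<union> (\<Union>B - A) \<union> R" using AV UBV by (auto simp: R_def)
  then have "card (verts T) \<le> card (A \<union> (\<Union>B - A)) + card R" by (metis card_Un_le)
  then have le: "card (verts T) \<le> card A + card (\<Union>B - A) + card R"
    using card_Un_le[of A "\<Union>B - A"] by linarith
  have UBA: "card (\<Union>B - A) \<le> card (\<Union>B)" using finUB by (simp add: card_mono)
  show ?thesis
  proof (cases "R = {}")
    case True
    \<comment> \<open>Here n \<le> |A| + 2|B| and 2|A| + 2|B| \<le> n. So \<open>A\<close> is empty
      and \<open>B\<close>, which is then all of \<open>F\<close>, is a perfect matching; n = 2(n -
      2) leaves only the path on four vertices.\<close>
    have A0: "card A = 0" and UB2: "2 * card B \<le> card (\<Union>B)"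
      and nB: "card (verts T) = 2 * card B"
      using le UBA UB half cAB True by auto
    have A: "A = {}" using A0 fAB by simp
    then have "F = B" using d2 BF by blast
    then have B4: "card B = 2" using nB F(2) n by simp
    then obtain f g where fg: "B = {f, g}" "f \<noteq> g" by (auto simp: card_2_iff)
    have dfg: "f \<inter> g = {}"
      using disjoint_if_card_Union[OF fAB(2) B2(1) UB2, of f g] fg by simp
    have Vfg: "verts T = f \<union> g" using VABR True A fg by auto
    have "f \<noteq> {}" "card f < card (verts T)" using B2(1)[of f] fg n by auto
    then obtain x y where xy: "x \<in> f" "y \<in> verts T - f" "{x, y} \<in> edges T"
      using exit[of f] Vfg by blast
    have "{x, y} \<noteq> f" "{x, y} \<noteq> g" using xy Vfg dfg by blast+
    then have xyF: "{x, y} \<in> edges T - F" using xy \<open>F = B\<close> fg by blast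
    obtain z where z: "f = {x, z}" "x \<noteq> z"
      using B2(1)[of f] fg xy(1) by (auto simp: card_2_iff insert_commute)
    \<comment> \<open>The middle edge of the path is \<open>{x, y}\<close>, so \<open>x\<close> can
      serve as the centre with pendant vertex \<open>z\<close>, and \<open>g\<close> is the only
      matching edge.\<close>
    show ?thesis
    proof (rule tree_matching_iso_star_corona[OF T, of x z "{g}"])
      fix e assume e: "e \<in> edges T" "e \<noteq> {x, z}" "e \<notin> {g}"
      then have "e \<in> edges T - F" using z fg \<open>F = B\<close> by blast
      then have "e = {x, y}" using one xyF by blast
      then show "x \<in> e" by simp
    qed (use z fg F \<open>F = B\<close> Vfg dfg in auto)
  next
    case False
    then obtain b where b: "b \<in> R" by blast
    then obtain a where a: "a \<in> A" "{b, a} \<in> edges T - F" using d1 by (auto simp: R_def)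
    have "R \<subseteq> {b}"
    proof
      fix v assume v: "v \<in> R"
      then obtain u where "u \<in> A" "{v, u} \<in> edges T - F" using d1 by (auto simp: R_def)
      \<comment> \<open>Both vertices need the one unsubdivided edge; \<open>v\<close> is not in
        \<open>A\<close>, so it is not \<open>a\<close>.\<close>
      then have "{v, u} = {b, a}" using one a by blast
      then show "v \<in> {b}" using v a by (auto simp: doubleton_eq_iff R_def)
    qed
    then have R: "R = {b}" using b by blast
    have "0 < card A" using a fAB card_gt_0_iff by blast
    \<comment> \<open>Now n \<le> |A| + 2|B| + 1 and 2|A| + 2|B| \<le> n with |A| \<ge> 1. Tightness
      makes \<open>B\<close> a matching and, through \<open>UBA2\<close>, keeps \<open>a\<close> off
      its edges.\<close>
    then have A1: "card A = 1" and UB2: "2 * card B \<le> card (\<Union>B)"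
      and UBA2: "card (\<Union>B - A) = card (\<Union>B)" and nB: "card (verts T) = 2 * card B + 2"
      using le UBA UB half cAB R by auto
    have A: "A = {a}" using A1 a by (auto simp: card_1_singleton_iff)
    have aUB: "a \<notin> \<Union>B"
    proof
      assume "a \<in> \<Union>B"
      then have "card (\<Union>B - A) < card (\<Union>B)" unfolding A by (rule card_Diff1_less[OF finUB])
      then show False using UBA2 by simp
    qed
    show ?thesis
    proof (rule tree_matching_iso_star_corona[OF T, of a b B])
      show "a \<noteq> b" using a b by (auto simp: R_def)
      show "{a, b} \<in> edges T" using a by (simp add: insert_commute)
      show "B \<noteq> {}" using nB n by auto
      show "verts T = {a, b} \<union> \<Union>B" using VABR A R aUB by auto
      show "b \<notin> \<Union>B" using b by (simp add: R_def)
      show "\<And>e f. e \<in> B \<Longrightarrow> f \<in> B \<Longrightarrow> e \<noteq> f \<Longrightarrow> e \<inter> f = {}"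
        using disjoint_if_card_Union[OF fAB(2) B2(1) UB2] by blast
      show "a \<in> e" if "e \<in> edges T" "e \<noteq> {a, b}" "e \<notin> B" for e
      proof -
        have "e \<in> F" using one[of e "{b, a}"] a that by (auto simp: insert_commute)
        then show ?thesis using d2 that A by blast
      qed
    qed (use BF F aUB in auto)
  qed
qed

section \<open>Domination in subdivided star coronas, and the converse direction\<close>

locale labelled_star_corona =
  fixes T :: "'a graph" and r :: nat and s l :: "nat \<Rightarrow> 'a"
  assumes r1: "1 \<le> r" and lab: "star_corona_labelling T r s l" and sg: "simple_graph T"
begin

lemma s_eq_iff [simp]: "i \<le> r \<Longrightarrow> j \<le> r \<Longrightarrow> s i = s j \<longleftrightarrow> i = j"
  and l_eq_iff [simp]: "i \<le> r \<Longrightarrow> j \<le> r \<Longrightarrow> l i = l j \<longleftrightarrow> i = j"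
  using lab by (auto simp: star_corona_labelling_def inj_on_eq_iff)

lemma s_neq_l [simp]: "i \<le> r \<Longrightarrow> j \<le> r \<Longrightarrow> s i \<noteq> l j"
  and l_neq_s [simp]: "i \<le> r \<Longrightarrow> j \<le> r \<Longrightarrow> l j \<noteq> s i"
proof -
  have "s ` {0..r} \<inter> l ` {0..r} = {}" using lab by (simp add: star_corona_labelling_def)
  then show "i \<le> r \<Longrightarrow> j \<le> r \<Longrightarrow> s i \<noteq> l j" "i \<le> r \<Longrightarrow> j \<le> r \<Longrightarrow> l j \<noteq> s i"
    by (metis atLeastAtMost_iff disjoint_iff imageI zero_le)+
qed

lemma V: "verts T = s ` {0..r} \<union> l ` {0..r}"
  and E: "edges T = (\<lambda>i. {s 0, s i}) ` {1..r} \<union> (\<lambda>i. {s i, l i}) ` {0..r}"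
  using lab unfolding star_corona_labelling_def by blast+

lemma finite_verts: "finite (verts T)"
  by (simp add: V)

lemma leaf_edge: "i \<le> r \<Longrightarrow> e \<in> edges T \<Longrightarrow> l i \<in> e \<Longrightarrow> e = {s i, l i}"
  by (auto simp: E)

lemma card_verts: "card (verts T) = 2 * r + 2"
proof -
  have "inj_on s {0..r}" "inj_on l {0..r}" "s ` {0..r} \<inter> l ` {0..r} = {}"
    using lab unfolding star_corona_labelling_def by blast+
  then show ?thesis by (simp add: V card_Un_disjoint card_image)
qed

lemma card_edges: "card (edges T) = 2 * r + 1"
proof -
  have "inj_on (\<lambda>i. {s 0, s i}) {1..r}" "inj_on (\<lambda>i. {s i, l i}) {0..r}"
    by (auto simp: inj_on_def doubleton_eq_iff)
  moreover have "(\<lambda>i. {s 0, s i}) ` {1..r} \<inter> (\<lambda>i. {s i, l i}) ` {0..r} = {}"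
    by (auto simp: doubleton_eq_iff)
  ultimately show ?thesis by (simp add: E card_Un_disjoint card_image)
qed

lemma domination_number_eq: "domination_number T = r + 1"
proof (rule antisym)
  have "dominating T (s ` {0..r})"
    unfolding dominating_def
  proof (intro conjI ballI)
    fix v assume "v \<in> verts T - s ` {0..r}"
    then obtain i where "i \<le> r" "v = l i" by (auto simp: V)
    then have "{v, s i} \<in> edges T" "s i \<in> s ` {0..r}" by (auto simp: E insert_commute)
    then show "\<exists>u \<in> s ` {0..r}. {v, u} \<in> edges T" by blast
  qed (auto simp: V)
  then have "domination_number T \<le> card (s ` {0..r})"
    by (rule domination_number_le[OF finite_verts])
  then show "domination_number T \<le> r + 1" using card_image_le[of "{0..r}" s] by simp
next
  obtain D where D: "dominating T D" "card D = domination_number T"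
    using domination_number_attained[OF finite_verts] .
  have finD: "finite D" using D finite_verts finite_subset by (auto simp: dominating_def)
  \<comment> \<open>The leaf \<open>l i\<close> can only be dominated by itself or by
    \<open>s i\<close>; \<open>p i\<close> picks such a vertex of \<open>D\<close>, and different
    indices give different vertices.\<close>
  define p where "p i = (if l i \<in> D then l i else s i)" for i
  have "p i \<in> D" if i: "i \<le> r" for i
  proof (cases "l i \<in> D")
    case False
    moreover have "l i \<in> verts T" using i by (simp add: V)
    ultimately obtain u where u: "u \<in> D" "{l i, u} \<in> edges T"
      using D unfolding dominating_def by blast
    then have "{l i, u} = {s i, l i}" using leaf_edge[OF i] by blast
    then have "u = s i" using i by (auto simp: doubleton_eq_iff)
    then show ?thesis using u p_def by simp
  qed (simp add: p_def)
  moreover have "inj_on p {0..r}" by (auto simp: inj_on_def p_def split: if_splits)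
  ultimately have "card {0..r} \<le> card D" by (intro card_inj_on_le[of p]) (auto simp: finD)
  then show "r + 1 \<le> domination_number T" using D by simp
qed

text \<open>One vertex per index suffices: the subdivision vertex of \<open>{s i, l i}\<close> if
  there is one, as it dominates both ends, and \<open>s i\<close> otherwise. The centre is always of
  the second kind, and it dominates the subdivision vertices of all star edges.\<close>

lemma domination_number_subdivide_le:
  assumes F: "F \<subseteq> edges T" "{s 0, l 0} \<notin> F"
  shows "domination_number (subdivide T F) \<le> r + 1"
proof -
  define X where "X = {i \<in> {1..r}. {s i, l i} \<in> F}"
  define A B where "A = insert (s 0) (s ` ({1..r} - X))" and "B = (\<lambda>i. {s i, l i}) ` X"
  have "dominating (subdivide T F) (A <+> B)"
    unfolding dominating_subdivide
  proof (intro conjI ballI)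
    fix v assume v: "v \<in> verts T - A"
    then consider i where "i \<in> X" "v = s i" | i where "i \<in> X" "v = l i"
      | i where "i \<le> r" "i \<notin> X" "v = l i"
      by (fastforce simp: V A_def)
    then show "(\<exists>e \<in> B. v \<in> e) \<or> (\<exists>u \<in> A. {v, u} \<in> edges T - F)"
    proof cases
      case 3
      have "{l i, s i} \<in> edges T - F"
        using 3 F(2) by (cases "i = 0") (auto simp: E X_def insert_commute)
      moreover have "s i \<in> A" using 3 by (cases "i = 0") (auto simp: A_def)
      ultimately show ?thesis using 3 by blast
    qed (auto simp: B_def)
  next
    fix e assume e: "e \<in> F - B"
    then consider i where "e = {s 0, s i}" | i where "i \<le> r" "e = {s i, l i}"
      using F(1) by (auto simp: E)
    then show "\<exists>u \<in> A. u \<in> e"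
    proof cases
      case 2
      then have "i = 0" using e by (cases "i = 0") (auto simp: B_def X_def)
      then show ?thesis using 2 by (auto simp: A_def)
    qed (auto simp: A_def)
  qed (auto simp: A_def B_def V X_def)
  moreover have "finite (verts (subdivide T F))"
    using simple_graph_subdivide[OF sg F(1)] by (simp add: simple_graph_def)
  ultimately have "domination_number (subdivide T F) \<le> card (A <+> B)"
    using domination_number_le by blast
  also have "\<dots> = card A + card B" by (simp add: card_Plus A_def B_def X_def)
  also have "card A \<le> Suc (card ({1..r} - X))"
    unfolding A_def by (metis card_image_le card_insert_le_m1 diff_Suc_1 finite_Diff finite_atLeastAtMost zero_less_Suc)
  also have "card B \<le> card X" unfolding B_def by (rule card_image_le) (simp add: X_def)
  also have "Suc (card ({1..r} - X)) + card X = r + 1"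
  proof -
    have "X \<subseteq> {1..r}" "finite X" by (auto simp: X_def)
    moreover from this have "card X \<le> r" using card_mono[of "{1..r}" X] by simp
    ultimately show ?thesis by (simp add: card_Diff_subset)
  qed
  finally show ?thesis by simp
qed

text \<open>Each leaf needs itself or the subdivision vertex of its pendant edge, which costs
  \<open>r + 1\<close> vertices. None of these dominates the subdivision vertex of
  \<open>{s 0, s 1}\<close>, so one more is required.\<close>

lemma domination_number_subdivide_all: "r + 1 < domination_number (subdivide T (edges T))"
proof -
  obtain A B where dom: "dominating (subdivide T (edges T)) (A <+> B)" and fAB: "finite A" "finite B"
    and c: "card A + card B = domination_number (subdivide T (edges T))"
    using domination_number_subdivide_attained[OF sg subset_refl] .
  have d0: "B \<subseteq> edges T" and d1: "\<And>v. v \<in> verts T \<Longrightarrow> v \<notin> A \<Longrightarrow> \<exists>e \<in> B. v \<in> e"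
    and d2: "\<And>e. e \<in> edges T \<Longrightarrow> e \<notin> B \<Longrightarrow> \<exists>u \<in> A. u \<in> e"
    using dom by (auto simp: dominating_subdivide)
  define p where "p i = (if l i \<in> A then Inl (l i) else Inr {s i, l i})" for i
  have "p i \<in> A <+> B" if i: "i \<le> r" for i
  proof (cases "l i \<in> A")
    case False
    moreover have "l i \<in> verts T" using i by (simp add: V)
    ultimately obtain e where e: "e \<in> B" "l i \<in> e" using d1 by blast
    then have "e = {s i, l i}" using leaf_edge[OF i] d0 by blast
    then show ?thesis using e False by (auto simp: p_def)
  qed (auto simp: p_def)
  then have sub: "p ` {0..r} \<subseteq> A <+> B" by auto
  have inj: "inj_on p {0..r}" by (auto simp: inj_on_def p_def doubleton_eq_iff split: if_splits)
  \<comment> \<open>The extra vertex is the subdivision vertex of \<open>{s 0, s 1}\<close> or one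
    of its neighbours \<open>s 0\<close> and \<open>s 1\<close>; the edge exists since
    \<open>r\<close> is at least 1.\<close>
  obtain z where z: "z \<in> A <+> B" "z \<notin> p ` {0..r}"
  proof (cases "{s 0, s 1} \<in> B")
    case True
    moreover have "Inr {s 0, s 1} \<notin> p ` {0..r}"
      using r1 by (auto simp: p_def doubleton_eq_iff split: if_splits)
    ultimately show ?thesis using that by blast
  next
    case False
    have "{s 0, s 1} \<in> edges T" using r1 by (auto simp: E)
    then obtain j where "j \<le> r" "s j \<in> A" using d2 False r1 by blast
    moreover then have "Inl (s j) \<notin> p ` {0..r}" by (auto simp: p_def split: if_splits)
    ultimately show ?thesis using that by blast
  qed
  have "card (insert z (p ` {0..r})) \<le> card (A <+> B)"
    by (rule card_mono) (use fAB sub z in auto)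
  then show ?thesis using z inj fAB c by (simp add: card_image card_Plus)
qed

end

text \<open>Criticality pins \<open>q\<close> from both sides. The witness with \<open>q - 1\<close>
  edges cannot be the whole edge set, so \<open>q\<close> is at most \<open>2 * r + 1\<close>; and
  if \<open>q\<close> were at most \<open>2 * r\<close>, some \<open>q\<close> edges could avoid
  \<open>{s 0, l 0}\<close> and leave \<gamma> unchanged.\<close>

lemma q_critical_star_corona:
  assumes r: "1 \<le> r" and iso: "graph_iso T (corona_K1 (star r))" and q: "q_critical q T"
  shows "q = card (verts T) - 1"
proof -
  have sg: "simple_graph T" and q1: "1 \<le> q"
    and up: "\<And>F. F \<subseteq> edges T \<Longrightarrow> card F = q \<Longrightarrow> domination_number T < domination_number (subdivide T F)"
    and "\<exists>F \<subseteq> edges T. card F = q - 1 \<and> domination_number (subdivide T F) = domination_number T"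
    using q by (auto simp: q_critical_def)
  then obtain F where F: "F \<subseteq> edges T" "card F = q - 1"
    "domination_number (subdivide T F) = domination_number T"
    by blast
  obtain s l where "star_corona_labelling T r s l" using star_corona_labelling_if_iso[OF sg iso] .
  then interpret labelled_star_corona T r s l using r sg by unfold_locales
  have "q - 1 \<noteq> card (edges T)"
  proof
    assume "q - 1 = card (edges T)"
    then have "F = edges T" using F finite_edges[OF sg] by (simp add: card_subset_eq)
    then show False using F(3) domination_number_subdivide_all domination_number_eq by simp
  qed
  moreover have "q - 1 \<le> card (edges T)" using F finite_edges[OF sg] card_mono by metis
  ultimately have "q \<le> 2 * r + 1" using card_edges by linarith
  moreover have "\<not> q \<le> 2 * r"
  proof
    assume "q \<le> 2 * r"
    moreover have "{s 0, l 0} \<in> edges T" by (auto simp: E)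
    ultimately have "q \<le> card (edges T - {{s 0, l 0}})" by (simp add: card_edges)
    then obtain K where "K \<subseteq> edges T - {{s 0, l 0}}" "card K = q"
      by (metis obtain_subset_with_card_n)
    then show False
      using up[of K] domination_number_subdivide_le[of K] domination_number_eq by fastforce
  qed
  ultimately show ?thesis using card_verts by simp
qed

theorem theorem3p9:
  fixes T :: "'a graph" and q :: nat
  assumes "is_tree T"
    and "3 \<le> card (verts T)"
    and "1 \<le> q"
    and "q_critical q T"
  shows "q = card (verts T) - 1 \<longleftrightarrow> (\<exists>r \<ge> 1. graph_iso T (corona_K1 (star r)))"
proof
  assume q: "q = card (verts T) - 1"
  obtain F where "F \<subseteq> edges T" "card F = q - 1"
    "domination_number (subdivide T F) = domination_number T"
    using assms(4) by (auto simp: q_critical_def)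
  \<comment> \<open>For q = n - 1 the witness of criticality has n - 2 edges, the size that
    \<open>tree_iso_star_corona\<close> asks for.\<close>
  then show "\<exists>r \<ge> 1. graph_iso T (corona_K1 (star r))"
    using tree_iso_star_corona[OF assms(1,2)] q by simp
next
  assume "\<exists>r \<ge> 1. graph_iso T (corona_K1 (star r))"
  then show "q = card (verts T) - 1" using q_critical_star_corona assms(4) by blast
qed

end
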